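(* Let $n\ge 5$, let $(x_1,y_1),\ldots,(x_n,y_n)\in\mathbb{R}^2$ be the vertices (in cyclic order) of a convex $n$-gon $A$, let $T$ denote the pentagram map, and let $(X,Y)=\lim_{k\to\infty}T^k(A)\in\mathbb{R}^2$ be the limit point of the pentagram map on $A$. Let $F=\mathbb{Q}(x_1,y_1,\ldots,x_n,y_n)\subseteq\mathbb{R}$ be the field generated by the coordinates. Then there is a field extension $K$ of $F$ (inside $\mathbb{C}$) with $[K:F]\le 3$ such that $X\in K$ and $Y\in K$.
   Context: A convex $n$-gon is a cyclically ordered tuple $A=(A_1,\ldots,A_n)$ of points of $\mathbb{R}^2$ that are, in this order, the vertices of a convex polygon, with no three vertices collinear; indices are taken modulo $n$. The pentagram map $T$ sends $A$ to the polygon $B=T(A)$ with vertices $B_i=\overleftrightarrow{A_{i-1}A_{i+1}}\cap\overleftrightarrow{A_iA_{i+2}}$, where $\overleftrightarrow{PQ}$ is the line through $P$ and $Q$. If $A$ is convex then $T(A)$ is convex and lies in the interior of $A$, so $T$ can be iterated. By a theorem of R. Schwartz, for convex $A$ the polygons $T^k(A)$, $k=0,1,2,\ldots$, converge to a single point of $\mathbb{R}^2$ (all vertices of $T^k(A)$ converge to this point); this point is denoted $\lim_{k\to\infty}T^k(A)$. *)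

theory Defs
  imports
    "HOL-Analysis.Analysis"
    "HOL-Algebra.Embedded_Algebras"
    "HOL-Algebra.Generated_Fields"
    "HOL-Algebra.Algebraic_Closure_Type"
begin

(* A cyclically ordered n-tuple is an n-periodic family indexed by the integers, so that
   index arithmetic modulo n is plain integer arithmetic; the tuple itself is A 1, ..., A n. *)
type_synonym polygon = "int \<Rightarrow> real \<times> real"

definition convex_polygon :: "nat \<Rightarrow> polygon \<Rightarrow> bool" where
  "convex_polygon n A \<longleftrightarrow>
     (\<forall>i. A (i + int n) = A i) \<and>
     inj_on A {1..int n} \<and>
     {v. v extreme_point_of (convex hull (range A))} = range A \<and>
     (\<forall>i. closed_segment (A i) (A (i + 1)) edge_of (convex hull (range A))) \<and>
     (\<forall>i\<in>{1..int n}. \<forall>j\<in>{1..int n}. \<forall>k\<in>{1..int n}.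
        i \<noteq> j \<longrightarrow> j \<noteq> k \<longrightarrow> i \<noteq> k \<longrightarrow> \<not> collinear {A i, A j, A k})"

(* For P distinct from Q, affine hull {P, Q} is the line through P and Q. *)
definition pentagram :: "polygon \<Rightarrow> polygon" where
  "pentagram A = (\<lambda>i. THE P. P \<in> affine hull {A (i - 1), A (i + 1)} \<inter> affine hull {A i, A (i + 2)})"

definition pentagram_limit :: "polygon \<Rightarrow> real \<times> real \<Rightarrow> bool" where
  "pentagram_limit A P \<longleftrightarrow> (\<forall>i. (\<lambda>k. (pentagram ^^ k) A i) \<longlonglongrightarrow> P)"

abbreviation complex_field :: "complex ring" where
  "complex_field \<equiv> ring_of_type_algebra"

(* The field Q(x_1, y_1, ..., x_n, y_n), viewed as a subfield of the complex numbers;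
   every subfield contains 1, hence the rationals, so these need not be adjoined. *)
definition coordinate_field :: "nat \<Rightarrow> polygon \<Rightarrow> complex set" where
  "coordinate_field n A =
     generate_field complex_field
       (complex_of_real ` (\<Union>i\<in>{1..int n}. {fst (A i), snd (A i)}))"

end

theory Submission
  imports Defs
begin

text \<open>Following Glick, attach to a polygon \<open>A\<close> the sum \<open>M\<close> of the projections of \<open>\<real>\<^sup>3\<close> onto the lines
  \<open>A\<^sub>i\<close> along the planes spanned by \<open>A\<^sub>i\<^sub>-\<^sub>1\<close> and \<open>A\<^sub>i\<^sub>+\<^sub>1\<close>. It is invariant under the pentagram map. At the limit
  point \<open>P\<close>, which lies inside all the short diagonals of every iterate, \<open>M P\<close> is a combination of the vertices
  of the \<open>k\<close>-th iterate with nonpositive weights whose sum \<open>\<mu>\<close> does not depend on \<open>k\<close>; letting \<open>k\<close> tend to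
  infinity gives \<open>M P = \<mu> P\<close>. If the eigenspace of \<open>\<mu>\<close> were more than a line, there would be an eigenvector on
  an edge of \<open>A\<close>, which forces \<open>\<mu> = 1\<close> and contradicts \<open>\<mu> \<le> 0\<close>. Since \<open>M\<close> is a \<open>3 \<times> 3\<close> matrix over the
  coordinate field \<open>F\<close>, the eigenvalue \<open>\<mu>\<close> has degree at most 3 and \<open>P\<close> is rational over \<open>F(\<mu>)\<close>.\<close>

section \<open>Eigenvectors over cubic extensions\<close>

lemma complex_field_simps:
  "carrier complex_field = UNIV" "x \<otimes>\<^bsub>complex_field\<^esub> y = x * y" "x \<oplus>\<^bsub>complex_field\<^esub> y = x + y"
  "\<one>\<^bsub>complex_field\<^esub> = 1" "\<zero>\<^bsub>complex_field\<^esub> = 0"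
  by (simp_all add: ring_of_type_algebra_def)

lemma field_complex_field: "field complex_field"
  by (rule field_from_type_algebra)

lemma a_inv_complex_field: "\<ominus>\<^bsub>complex_field\<^esub> x = - x"
proof -
  interpret C: field complex_field by (rule field_complex_field)
  show ?thesis
    using C.minus_equality[of "- x" x] by (simp add: complex_field_simps)
qed

lemma m_inv_complex_field:
  assumes "x \<noteq> 0"
  shows "inv\<^bsub>complex_field\<^esub> x = inverse x"
proof -
  interpret C: field complex_field by (rule field_complex_field)
  show ?thesis
    using C.comm_inv_char[of x "inverse x"] assms by (simp add: complex_field_simps)
qed

lemma subfield_complex_field_closed:
  assumes F: "subfield F complex_field"
  shows "0 \<in> F" "1 \<in> F"
    and "x \<in> F \<Longrightarrow> - x \<in> F"
    and "x \<in> F \<Longrightarrow> y \<in> F \<Longrightarrow> x + y \<in> F"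
    and "x \<in> F \<Longrightarrow> y \<in> F \<Longrightarrow> x - y \<in> F"
    and "x \<in> F \<Longrightarrow> y \<in> F \<Longrightarrow> x * y \<in> F"
    and "x \<in> F \<Longrightarrow> y \<in> F \<Longrightarrow> x / y \<in> F"
proof -
  interpret C: field complex_field by (rule field_complex_field)
  note R = subfieldE(1)[OF F]
  show "0 \<in> F" "1 \<in> F"
    using subringE(2,3)[OF R] by (simp_all add: complex_field_simps)
  show neg: "- x \<in> F" if "x \<in> F" for x
    using subringE(5)[OF R that] by (simp add: a_inv_complex_field)
  show add: "x + y \<in> F" if "x \<in> F" "y \<in> F" for x y
    using subringE(7)[OF R that] by (simp add: complex_field_simps)
  show "x - y \<in> F" if "x \<in> F" "y \<in> F"
    using add[OF that(1) neg[OF that(2)]] by simp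
  show mult: "x * y \<in> F" if "x \<in> F" "y \<in> F" for x y
    using subringE(6)[OF R that] by (simp add: complex_field_simps)
  show "x / y \<in> F" if "x \<in> F" "y \<in> F"
  \<comment> \<open>Since \<open>x / 0 = 0\<close> lies in \<open>F\<close>, closure under division
    carries no side condition.\<close>
  proof (cases "y = 0")
    case True
    then show ?thesis using \<open>0 \<in> F\<close> by simp
  next
    case False
    then have "inverse y \<in> F"
      using C.subfield_m_inv(1)[OF F, of y] that
      by (simp add: complex_field_simps m_inv_complex_field)
    then show ?thesis using mult[OF that(1)] by (simp add: divide_inverse)
  qed
qed

text \<open>The simple extension \<open>F(x)\<close> has the degree of the minimal polynomial of
  \<open>x\<close>, and that polynomial divides the given monic cubic.\<close>

lemma cubic_extension:
  fixes x :: complex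
  assumes F: "subfield F complex_field" and coeffs: "a \<in> F" "b \<in> F" "c \<in> F"
    and root: "x^3 + a * x^2 + b * x + c = 0"
  obtains K d where "subfield K complex_field" "F \<subseteq> K" "x \<in> K" "d \<le> 3"
    "ring.dimension complex_field d F K"
proof -
  interpret C: field complex_field by (rule field_complex_field)
  \<comment> \<open>Coefficient lists start with the leading coefficient.\<close>
  let ?p = "[1, a, b, c]"
  have x: "x \<in> carrier complex_field" by (simp add: complex_field_simps)
  have p: "?p \<in> carrier (univ_poly complex_field F)"
    using coeffs subfield_complex_field_closed(2)[OF F]
    by (simp add: univ_poly_def polynomial_def complex_field_simps)
  have pow: "x [^]\<^bsub>complex_field\<^esub> k = x ^ k" for k :: nat
    by (induction k) (simp_all add: complex_field_simps)
  have eval: "C.eval ?p x = \<zero>\<^bsub>complex_field\<^esub>"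
  proof -
    have "C.eval ?p x = x^3 + (a * x^2 + (b * x + c))"
      by (simp add: complex_field_simps pow power2_eq_square power3_eq_cube)
    also have "\<dots> = 0"
      using root by (simp only: add.assoc)
    finally show ?thesis by (simp add: complex_field_simps)
  qed
  have alg: "(C.algebraic over F) x"
    by (rule C.algebraicI[OF p _ eval]) simp
  have "degree (C.Irr F x) \<le> degree ?p"
    by (rule C.pdivides_imp_degree_le[OF subfieldE(1)[OF F] C.IrrE(1)[OF F x alg] p _
          C.Irr_minimal[OF F x alg p eval]]) simp
  then have "degree (C.Irr F x) \<le> 3" by simp
  moreover have "subfield (C.simple_extension F x) complex_field"
    using C.simple_extension_is_subfield[OF F x] alg by simp
  moreover have "F \<subseteq> C.simple_extension F x"
    by (rule C.simple_extension_incl[OF subfieldE(3)[OF F] x])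
  moreover have "x \<in> C.simple_extension F x"
    by (rule C.simple_extension_mem[OF subfieldE(1)[OF F] x])
  moreover have "C.dimension (degree (C.Irr F x)) F (C.simple_extension F x)"
    by (rule C.dimension_simple_extension[OF F x alg])
  ultimately show ?thesis by (intro that)
qed

text \<open>The vector \<open>(x, y, 1)\<close> is an eigenvector of the matrix with rows \<open>(b\<^sub>i, c\<^sub>i, a\<^sub>i)\<close>;
  uniqueness says that its eigenspace is a line, so Cramer's rule recovers \<open>(x, y)\<close> from the eigenvalue.\<close>
lemma eigenvector_cubic_extension:
  fixes x y \<mu> :: real
  assumes F: "subfield F complex_field"
    and coeffs: "complex_of_real ` {a1, b1, c1, a2, b2, c2, a3, b3, c3} \<subseteq> F"
    and eq: "a1 + b1 * x + c1 * y = \<mu> * x" "a2 + b2 * x + c2 * y = \<mu> * y" "a3 + b3 * x + c3 * y = \<mu>"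
    and unique: "\<And>x' y'. a1 + b1 * x' + c1 * y' = \<mu> * x' \<Longrightarrow> a2 + b2 * x' + c2 * y' = \<mu> * y' \<Longrightarrow>
        a3 + b3 * x' + c3 * y' = \<mu> \<Longrightarrow> x' = x \<and> y' = y"
  shows "\<exists>K. subfield K complex_field \<and> F \<subseteq> K \<and> (\<exists>d\<le>3. ring.dimension complex_field d F K) \<and>
    complex_of_real x \<in> K \<and> complex_of_real y \<in> K"
proof -
  \<comment> \<open>Up to sign the trace, the sum of the principal minors and the determinant: the
    coefficients of the characteristic polynomial.\<close>
  let ?a = "- (b1 + c2 + a3)"
  let ?b = "b1 * c2 - c1 * b2 + b1 * a3 - a1 * b3 + c2 * a3 - a2 * c3"
  let ?c = "- (b1 * (c2 * a3 - a2 * c3) - c1 * (b2 * a3 - a2 * b3) + a1 * (b2 * c3 - c2 * b3))"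
  have "\<mu>^3 + ?a * \<mu>^2 + ?b * \<mu> + ?c = 0" (is "?char = 0")
  proof -
    \<comment> \<open>Eliminating the last column by the eigenvector equations leaves a polynomial
      identity to check.\<close>
    have a: "a1 = \<mu> * x - b1 * x - c1 * y" "a2 = \<mu> * y - b2 * x - c2 * y" "a3 = \<mu> - b3 * x - c3 * y"
      using eq by simp_all
    show ?thesis unfolding a by (simp add: algebra_simps power2_eq_square power3_eq_cube)
  qed
  then have "complex_of_real ?char = 0" by (simp only: of_real_0)
  then have root: "complex_of_real \<mu> ^ 3 + complex_of_real ?a * complex_of_real \<mu> ^ 2
      + complex_of_real ?b * complex_of_real \<mu> + complex_of_real ?c = 0"
    by (simp only: of_real_add of_real_mult of_real_power)
  note Fcl = subfield_complex_field_closed[OF F]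
  have "complex_of_real ?a \<in> F" "complex_of_real ?b \<in> F" "complex_of_real ?c \<in> F"
    using coeffs unfolding of_real_add of_real_mult of_real_diff of_real_minus
    by (auto intro!: Fcl(3-6))
  from cubic_extension[OF F this root] obtain K d where
    K: "subfield K complex_field" "F \<subseteq> K" "complex_of_real \<mu> \<in> K" "d \<le> 3"
      "ring.dimension complex_field d F K" .
  note Kcl = subfield_complex_field_closed[OF K(1)]
  have cramer: "complex_of_real x \<in> K \<and> complex_of_real y \<in> K"
    if "p * x + q * y = r" "s * x + t * y = u" "p * t - q * s \<noteq> 0"
      and "complex_of_real ` {p, q, r, s, t, u} \<subseteq> K" for p q r s t u :: real
  proof -
    have x: "x = (r * t - q * u) / (p * t - q * s)" and y: "y = (p * u - r * s) / (p * t - q * s)"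
      using that(3) by (simp_all add: eq_divide_eq flip: that(1,2)) (simp_all add: algebra_simps)
    show ?thesis
      unfolding x y of_real_divide of_real_diff of_real_mult
      using that(4) by (auto intro!: Kcl(5-7))
  qed
  have in_K: "complex_of_real ` {b1 - \<mu>, c1, - a1, b2, c2 - \<mu>, - a2, b3, c3, \<mu> - a3} \<subseteq> K"
    using coeffs K(2,3) by (auto intro!: Kcl(3,5))
  \<comment> \<open>After subtracting \<open>\<mu>\<close> on the diagonal, the first two columns
    are independent, so some two rows form a nonsingular system for \<open>(x, y)\<close>.\<close>
  have "(b1 - \<mu>) * (c2 - \<mu>) - c1 * b2 \<noteq> 0 \<or> (b1 - \<mu>) * c3 - c1 * b3 \<noteq> 0 \<or> b2 * c3 - (c2 - \<mu>) * b3 \<noteq> 0"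
  proof (rule ccontr)
    assume "\<not> ?thesis"
    then have minors: "(b1 - \<mu>) * (c2 - \<mu>) = c1 * b2" "(b1 - \<mu>) * c3 = c1 * b3" "b2 * c3 = (c2 - \<mu>) * b3"
      by auto
    \<comment> \<open>A kernel vector of the two columns could be added to \<open>(x, y)\<close>,
      contradicting uniqueness.\<close>
    have no_kernel: "u = 0 \<and> v = 0"
      if "(b1 - \<mu>) * u + c1 * v = 0" "b2 * u + (c2 - \<mu>) * v = 0" "b3 * u + c3 * v = 0" for u v
      using unique[of "x + u" "y + v"] eq that by (simp add: algebra_simps)
    \<comment> \<open>Vanishing minors put each row, turned by a right angle, into the kernel. Hence
      all rows vanish, and \<open>(1, 0)\<close> is a kernel vector.\<close>
    have "b1 - \<mu> = 0 \<and> c1 = 0"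
      using no_kernel[of "- c1" "b1 - \<mu>"] minors by (auto simp: algebra_simps)
    moreover have "b2 = 0 \<and> c2 - \<mu> = 0"
      using no_kernel[of "- (c2 - \<mu>)" b2] minors by (auto simp: algebra_simps)
    moreover have "b3 = 0 \<and> c3 = 0"
      using no_kernel[of "- c3" b3] minors by (auto simp: algebra_simps)
    ultimately show False
      using no_kernel[of 1 0] by simp
  qed
  moreover have "(b1 - \<mu>) * x + c1 * y = - a1" "b2 * x + (c2 - \<mu>) * y = - a2" "b3 * x + c3 * y = \<mu> - a3"
    using eq by (simp_all add: algebra_simps)
  ultimately have "complex_of_real x \<in> K \<and> complex_of_real y \<in> K"
    using in_K
      cramer[of "b1 - \<mu>" c1 "- a1" b2 "c2 - \<mu>" "- a2"]
      cramer[of "b1 - \<mu>" c1 "- a1" b3 c3 "\<mu> - a3"]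
      cramer[of b2 "c2 - \<mu>" "- a2" b3 c3 "\<mu> - a3"] by auto
  with K show ?thesis by blast
qed

section \<open>Orientation and affine functions in the plane\<close>

text \<open>Twice the signed area of the triangle, or the determinant of the three homogeneous
  coordinate vectors.\<close>

definition orient :: "real \<times> real \<Rightarrow> real \<times> real \<Rightarrow> real \<times> real \<Rightarrow> real" where
  "orient P Q R = (fst Q - fst P) * (snd R - snd P) - (snd Q - snd P) * (fst R - fst P)"

text \<open>Affine functions stand for linear functionals on homogeneous coordinates. The set
  \<open>S\<close> tracks the field of the coefficients: \<open>UNIV\<close> for geometry, the real
  elements of the coordinate field at the end.\<close>

definition affine_over :: "real set \<Rightarrow> (real \<times> real \<Rightarrow> real) \<Rightarrow> bool" where
  "affine_over S f \<longleftrightarrow> (\<exists>a\<in>S. \<exists>b\<in>S. \<exists>c\<in>S. \<forall>v. f v = a + b * fst v + c * snd v)"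

abbreviation affine_fun :: "(real \<times> real \<Rightarrow> real) \<Rightarrow> bool" where
  "affine_fun \<equiv> affine_over UNIV"

lemma orient_rotate: "orient Q R P = orient P Q R"
  by (simp add: orient_def algebra_simps)

lemma orient_swap: "orient P R Q = - orient P Q R"
  by (simp add: orient_def algebra_simps)

lemma orient_degenerate [simp]: "orient P P Q = 0" "orient P Q Q = 0" "orient P Q P = 0"
  by (simp_all add: orient_def)

text \<open>The three-term Pluecker relation for the vectors from \<open>P\<close> to the other
  points expresses the product with \<open>orient P R T\<close> by two positive products. The factor
  \<open>s\<close> covers both orientations.\<close>

lemma orient_transitive:
  assumes "s * orient P Q R > 0" "s * orient P Q S > 0" "s * orient P Q T > 0"
    and "s * orient P R S > 0" "s * orient P S T > 0"
  shows "s * orient P R T > 0"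
proof -
  have "orient P Q S * orient P R T = orient P Q R * orient P S T + orient P Q T * orient P R S"
    by (simp add: orient_def algebra_simps)
  then have "(s * s) * (orient P Q S * orient P R T)
      = (s * s) * (orient P Q R * orient P S T + orient P Q T * orient P R S)"
    by simp
  then have "(s * orient P Q S) * (s * orient P R T)
      = (s * orient P Q R) * (s * orient P S T) + (s * orient P Q T) * (s * orient P R S)"
    by (simp only: distrib_left ac_simps)
  also have "\<dots> > 0"
    by (rule add_pos_pos[OF mult_pos_pos[OF assms(1,5)] mult_pos_pos[OF assms(3,4)]])
  finally show ?thesis
    using assms(2) by (rule zero_less_mult_pos)
qed

lemma affine_fun_const: "affine_fun (\<lambda>_. k)"
  unfolding affine_over_def by (rule bexI[of _ k], rule bexI[of _ 0], rule bexI[of _ 0]) auto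

lemma affine_fun_fst: "affine_fun fst"
  unfolding affine_over_def by (rule bexI[of _ 0], rule bexI[of _ 1], rule bexI[of _ 0]) auto

lemma affine_fun_snd: "affine_fun snd"
  unfolding affine_over_def by (rule bexI[of _ 0], rule bexI[of _ 0], rule bexI[of _ 1]) auto

lemma affine_over_scale:
  assumes "affine_over S f" "k \<in> S" "\<And>x y. x \<in> S \<Longrightarrow> y \<in> S \<Longrightarrow> x * y \<in> S"
  shows "affine_over S (\<lambda>v. k * f v)"
proof -
  obtain a b c where "a \<in> S" "b \<in> S" "c \<in> S" and f: "\<And>v. f v = a + b * fst v + c * snd v"
    using assms(1) unfolding affine_over_def by blast
  then have "k * a \<in> S" "k * b \<in> S" "k * c \<in> S"
    using assms(2,3) by auto
  moreover have "k * f v = k * a + (k * b) * fst v + (k * c) * snd v" for v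
    by (simp add: f algebra_simps)
  ultimately show ?thesis unfolding affine_over_def by blast
qed

lemma affine_over_add:
  assumes "affine_over S f" "affine_over S g" "\<And>x y. x \<in> S \<Longrightarrow> y \<in> S \<Longrightarrow> x + y \<in> S"
  shows "affine_over S (\<lambda>v. f v + g v)"
proof -
  obtain a b c a' b' c' where "a \<in> S" "b \<in> S" "c \<in> S" "a' \<in> S" "b' \<in> S" "c' \<in> S"
    and f: "\<And>v. f v = a + b * fst v + c * snd v" and g: "\<And>v. g v = a' + b' * fst v + c' * snd v"
    using assms(1,2) unfolding affine_over_def by blast
  then have "a + a' \<in> S" "b + b' \<in> S" "c + c' \<in> S"
    using assms(3) by auto
  moreover have "f v + g v = (a + a') + (b + b') * fst v + (c + c') * snd v" for v
    by (simp add: f g algebra_simps)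
  ultimately show ?thesis unfolding affine_over_def by blast
qed

lemma affine_over_sum:
  assumes "finite I" "\<And>i. i \<in> I \<Longrightarrow> affine_over S (f i)"
    and "0 \<in> S" "\<And>x y. x \<in> S \<Longrightarrow> y \<in> S \<Longrightarrow> x + y \<in> S"
  shows "affine_over S (\<lambda>v. \<Sum>i\<in>I. f i v)"
  using assms(1,2)
proof (induction I)
  case empty
  show ?case
    unfolding affine_over_def using assms(3)
    by (intro bexI[of _ 0]) auto
next
  case (insert i I)
  then show ?case
    using affine_over_add[OF _ _ assms(4), where f = "f i" and g = "\<lambda>v. \<Sum>i\<in>I. f i v"]
    by simp
qed

lemma affine_over_orient:
  assumes "{fst P, snd P, fst R, snd R} \<subseteq> S"
    and "\<And>x y. x \<in> S \<Longrightarrow> y \<in> S \<Longrightarrow> x - y \<in> S" "\<And>x y. x \<in> S \<Longrightarrow> y \<in> S \<Longrightarrow> x * y \<in> S"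
  shows "affine_over S (\<lambda>v. orient P v R)"
proof -
  have "orient P v R = (snd P * fst R - fst P * snd R) + (snd R - snd P) * fst v + (fst P - fst R) * snd v" for v
    by (simp add: orient_def algebra_simps)
  moreover have "snd P * fst R - fst P * snd R \<in> S" "snd R - snd P \<in> S" "fst P - fst R \<in> S"
    using assms(1) by (auto intro!: assms(2,3))
  ultimately show ?thesis unfolding affine_over_def by blast
qed

lemma affine_fun_orient: "affine_fun (\<lambda>v. orient P v R)" "affine_fun (\<lambda>v. orient P R v)"
proof -
  show "affine_fun (\<lambda>v. orient P v R)" for P R
    by (rule affine_over_orient) auto
  from this[of R P] show "affine_fun (\<lambda>v. orient P R v)"
    by (simp add: orient_rotate[of R _ P])
qed

lemma affine_fun_convex_comb:
  assumes "affine_fun f"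
  shows "f ((1 - t) *\<^sub>R P + t *\<^sub>R Q) = (1 - t) * f P + t * f Q"
proof -
  obtain a b c where "\<And>v. f v = a + b * fst v + c * snd v"
    using assms unfolding affine_over_def by blast
  then show ?thesis by (simp add: algebra_simps)
qed

text \<open>Barycentric interpolation with the denominator cleared, so degenerate triangles are
  covered too.\<close>

lemma affine_fun_barycentric:
  assumes "affine_fun f"
  shows "f v * orient P Q R = f P * orient v Q R + f Q * orient P v R + f R * orient P Q v"
proof -
  obtain a b c where f: "\<And>v. f v = a + b * fst v + c * snd v"
    using assms unfolding affine_over_def by blast
  show ?thesis unfolding f orient_def by (simp add: algebra_simps)
qed

lemma affine_fun_convex_sets:
  assumes "affine_fun f"
  shows "convex {v. f v \<le> 0}" "convex {v. f v > 0}" "closed {v. f v \<le> 0}"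
proof -
  obtain a b c where f: "f = (\<lambda>v. a + b * fst v + c * snd v)"
    using assms unfolding affine_over_def by blast
  have eq: "f v = a + inner (b, c) v" for v
    by (cases v) (simp add: f)
  have "{v. f v \<le> 0} = {v. inner (b, c) v \<le> - a}" "{v. f v > 0} = {v. inner (b, c) v > - a}"
    by (auto simp: eq)
  then show "convex {v. f v \<le> 0}" "convex {v. f v > 0}" "closed {v. f v \<le> 0}"
    by (simp_all only: convex_halfspace_le convex_halfspace_gt closed_halfspace_le)
qed

section \<open>Lines and crossing diagonals\<close>

lemma line_iff:
  fixes P :: "'a :: real_vector"
  shows "V \<in> affine hull {P, Q} \<longleftrightarrow> (\<exists>t. V = (1 - t) *\<^sub>R P + t *\<^sub>R Q)"
proof
  assume "V \<in> affine hull {P, Q}"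
  then obtain u t where "V = u *\<^sub>R P + t *\<^sub>R Q" "u + t = 1"
    unfolding affine_hull_2 by blast
  moreover from this have "u = 1 - t" by simp
  ultimately show "\<exists>t. V = (1 - t) *\<^sub>R P + t *\<^sub>R Q" by blast
next
  assume "\<exists>t. V = (1 - t) *\<^sub>R P + t *\<^sub>R Q"
  then obtain t where "V = (1 - t) *\<^sub>R P + t *\<^sub>R Q" ..
  then show "V \<in> affine hull {P, Q}"
    unfolding affine_hull_2 by (intro CollectI exI[of _ "1 - t"] exI[of _ t]) simp
qed

lemma orient_zero_imp_line:
  assumes "orient P Q R = 0" "P \<noteq> Q"
  obtains x where "R = (1 - x) *\<^sub>R P + x *\<^sub>R Q"
proof -
  have "\<exists>x. fst R - fst P = x * (fst Q - fst P) \<and> snd R - snd P = x * (snd Q - snd P)"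
  proof (cases "fst Q = fst P")
    case True
    then have neq: "snd Q \<noteq> snd P" using assms(2) by (simp add: prod_eq_iff)
    have "fst R = fst P"
      using assms(1) True neq by (simp add: orient_def)
    then show ?thesis
      using True neq by (intro exI[of _ "(snd R - snd P) / (snd Q - snd P)"]) simp
  next
    case False
    then show ?thesis
      using assms(1) by (intro exI[of _ "(fst R - fst P) / (fst Q - fst P)"])
        (simp add: orient_def field_simps)
  qed
  then obtain x where "fst R - fst P = x * (fst Q - fst P)" "snd R - snd P = x * (snd Q - snd P)" by blast
  then have "R = (1 - x) *\<^sub>R P + x *\<^sub>R Q" by (simp add: prod_eq_iff algebra_simps)
  then show ?thesis by (rule that)
qed

lemma diagonals_meet:
  assumes pos: "s * orient P Q R > 0" "s * orient P Q S > 0" "s * orient P R S > 0" "s * orient Q R S > 0"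
  obtains t u where "0 < t" "t < 1" "0 < u" "u < 1"
    "(THE V. V \<in> affine hull {P, R} \<inter> affine hull {Q, S}) = (1 - t) *\<^sub>R P + t *\<^sub>R R"
    "(1 - t) *\<^sub>R P + t *\<^sub>R R = (1 - u) *\<^sub>R Q + u *\<^sub>R S"
proof -
  \<comment> \<open>\<open>d\<close> is twice the signed area of the quadrilateral, here cut along
    \<open>QS\<close> and in \<open>d'\<close> along \<open>PR\<close>. The ratios \<open>t\<close>
    and \<open>u\<close> place the crossing point on the two diagonals.\<close>
  define d where "d = orient P Q S + orient Q R S"
  define t where "t = orient P Q S / d"
  define u where "u = orient P Q R / d"
  have d': "d = orient P Q R + orient P R S"
    by (simp add: d_def orient_def algebra_simps)
  have "s * d > 0"
    unfolding d_def distrib_left using pos(2,4) by (rule add_pos_pos)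
  then have [simp]: "s \<noteq> 0" "d \<noteq> 0" by auto
  have dt: "d * t = orient P Q S" and du: "d * u = orient P Q R"
    by (simp_all add: t_def u_def)
  have "d * (1 - t) = orient Q R S" "d * (1 - u) = orient P R S"
    unfolding right_diff_distrib dt du by (simp add: d_def, simp add: d')
  note dtu = dt du this
  have tu: "0 < t" "0 < 1 - t" "0 < u" "0 < 1 - u"
    using pos[folded dtu, folded mult.assoc] zero_less_mult_pos[OF _ \<open>s * d > 0\<close>] by blast+
  have "d *\<^sub>R ((1 - t) *\<^sub>R P + t *\<^sub>R R) = d *\<^sub>R ((1 - u) *\<^sub>R Q + u *\<^sub>R S)"
  proof -
    have eqs: "d *\<^sub>R ((1 - t) *\<^sub>R P + t *\<^sub>R R) = orient Q R S *\<^sub>R P + orient P Q S *\<^sub>R R"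
      "d *\<^sub>R ((1 - u) *\<^sub>R Q + u *\<^sub>R S) = orient P R S *\<^sub>R Q + orient P Q R *\<^sub>R S"
      by (simp_all only: scaleR_add_right scaleR_scaleR dtu)
    show ?thesis
      unfolding eqs by (simp add: prod_eq_iff orient_def algebra_simps)
  qed
  then have meet: "(1 - t) *\<^sub>R P + t *\<^sub>R R = (1 - u) *\<^sub>R Q + u *\<^sub>R S"
    by simp
  have "(THE V. V \<in> affine hull {P, R} \<inter> affine hull {Q, S}) = (1 - t) *\<^sub>R P + t *\<^sub>R R" (is "_ = ?V")
  proof (rule the_equality)
    have "?V \<in> affine hull {P, R}"
      unfolding line_iff by (rule exI[of _ t]) (rule refl)
    moreover have "?V \<in> affine hull {Q, S}"
      unfolding line_iff by (rule exI[of _ u]) (rule meet)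
    ultimately show "?V \<in> affine hull {P, R} \<inter> affine hull {Q, S}" by simp
  next
    fix V assume V: "V \<in> affine hull {P, R} \<inter> affine hull {Q, S}"
    then obtain a a' where a: "V = (1 - a) *\<^sub>R P + a *\<^sub>R R" "V = (1 - a') *\<^sub>R Q + a' *\<^sub>R S"
      unfolding Int_iff line_iff by blast
    have on_QS: "orient Q S ((1 - x) *\<^sub>R Q + x *\<^sub>R S) = 0" for x
      by (simp add: affine_fun_convex_comb[OF affine_fun_orient(2)])
    \<comment> \<open>Orientation against \<open>QS\<close> changes along \<open>PR\<close> with
      slope \<open>- d\<close>, which is nonzero, so \<open>PR\<close> has only one point on
      \<open>QS\<close>.\<close>
    have along: "orient Q S ((1 - x) *\<^sub>R P + x *\<^sub>R R) = orient P Q S - x * d" for x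
      unfolding affine_fun_convex_comb[OF affine_fun_orient(2)] d_def orient_rotate[of Q S P]
        orient_swap[of Q S R] by (simp add: algebra_simps)
    have "a * d = t * d"
      using on_QS[of a'] on_QS[of u] along[of a] along[of t] unfolding meet[symmetric] a(2)[symmetric] a(1)[symmetric]
      by simp
    then show "V = ?V" using a(1) by simp
  qed
  then show ?thesis using that[of t u] tu meet by simp
qed

section \<open>Periodic families indexed by the integers\<close>

lemma sum_periodic_interval:
  fixes f :: "int \<Rightarrow> 'a :: comm_monoid_add"
  assumes "\<And>i. f (i + int n) = f i"
  shows "(\<Sum>i\<in>{a..<a + int n}. f i) = (\<Sum>i\<in>{0..<int n}. f i)"
proof -
  have step: "(\<Sum>i\<in>{a + 1..<a + 1 + int n}. f i) = (\<Sum>i\<in>{a..<a + int n}. f i)" for a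
  proof (cases "n = 0")
    case False
    then have "{a + 1..<a + 1 + int n} = insert (a + int n) {a + 1..<a + int n}"
      "{a..<a + int n} = insert a {a + 1..<a + int n}" by auto
    then show ?thesis by (simp add: assms)
  qed simp
  show ?thesis
  proof (induction a rule: int_induct[of _ 0])
    case (step1 i)
    then show ?case by (simp add: step)
  next
    case (step2 i)
    then show ?case using step[of "i - 1"] by simp
  qed simp
qed

lemma sum_periodic_shift:
  fixes f :: "int \<Rightarrow> 'a :: comm_monoid_add"
  assumes "\<And>i. f (i + int n) = f i"
  shows "(\<Sum>i\<in>{0..<int n}. f (i + k)) = (\<Sum>i\<in>{0..<int n}. f i)"
proof -
  have "(\<Sum>i\<in>{0..<int n}. f (i + k)) = (\<Sum>i\<in>{k..<k + int n}. f i)"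
    by (rule sum.reindex_bij_witness[of _ "\<lambda>i. i - k" "\<lambda>i. i + k"]) auto
  then show ?thesis using sum_periodic_interval[of f n k] assms by simp
qed

lemma periodic_add_multiple:
  fixes f :: "int \<Rightarrow> 'a"
  assumes "\<And>i. f (i + int n) = f i"
  shows "f (i + k * int n) = f i"
proof (induction k rule: int_induct[of _ 0])
  case (step1 k)
  then show ?case using assms[of "i + k * int n"] by (simp add: algebra_simps)
next
  case (step2 k)
  then show ?case using assms[of "i + (k - 1) * int n"] by (simp add: algebra_simps)
qed simp

lemma periodic_representative:
  fixes f :: "int \<Rightarrow> 'a"
  assumes "\<And>i. f (i + int n) = f i" "n > 0"
  obtains j where "j \<in> {a..<a + int n}" "f j = f i"
proof
  show "a + (i - a) mod int n \<in> {a..<a + int n}"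
    using assms(2) by simp
  have "i = a + (i - a) mod int n + (i - a) div int n * int n"
    by simp
  then show "f (a + (i - a) mod int n) = f i"
    using periodic_add_multiple[of f n "a + (i - a) mod int n", OF assms(1)] by metis
qed

lemma periodic_finite_range:
  fixes f :: "int \<Rightarrow> 'a"
  assumes per: "\<And>i. f (i + int n) = f i" and n: "n > 0"
  shows "finite (range f)"
proof -
  have "range f \<subseteq> f ` {0..<int n}"
  proof
    fix v assume "v \<in> range f"
    then obtain i where "v = f i" by blast
    moreover obtain j where "j \<in> {0..<0 + int n}" "f j = f i"
      by (rule periodic_representative[of f n 0 i, OF per n]) auto
    ultimately show "v \<in> f ` {0..<int n}" by (metis add_0 image_eqI)
  qed
  then show ?thesis by (rule finite_subset) simp
qed

lemma pentagram_periodic: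
  assumes "\<And>i. A (i + int n) = A i"
  shows "pentagram A (i + int n) = pentagram A i"
proof -
  have "A (i + int n - 1) = A (i - 1)" "A (i + int n + 1) = A (i + 1)" "A (i + int n + 2) = A (i + 2)"
    using assms[of "i - 1"] assms[of "i + 1"] assms[of "i + 2"] by (simp_all add: algebra_simps)
  then show ?thesis by (simp add: pentagram_def assms)
qed

section \<open>Invariance of Glick's operator\<close>

text \<open>In homogeneous coordinates \<open>v \<mapsto> ear A i v \<cdot> A\<^sub>i\<close> is the projection onto \<open>A\<^sub>i\<close> along the diagonal
  \<open>A\<^sub>i\<^sub>-\<^sub>1A\<^sub>i\<^sub>+\<^sub>1\<close>. Glick's operator is \<open>n\<close> times the identity minus the sum of these projections, and
  \<open>ear_sum n A g v\<close> is the functional \<open>g\<close> evaluated on that sum.\<close>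
definition ear :: "polygon \<Rightarrow> int \<Rightarrow> real \<times> real \<Rightarrow> real" where
  "ear A i v = orient (A (i - 1)) v (A (i + 1)) / orient (A (i - 1)) (A i) (A (i + 1))"

definition ear_sum :: "nat \<Rightarrow> polygon \<Rightarrow> (real \<times> real \<Rightarrow> real) \<Rightarrow> real \<times> real \<Rightarrow> real" where
  "ear_sum n A g v = (\<Sum>i\<in>{0..<int n}. ear A i v * g (A i))"

lemma affine_fun_ear: "affine_fun (ear A i)"
proof -
  have "ear A i = (\<lambda>v. inverse (orient (A (i - 1)) (A i) (A (i + 1))) * orient (A (i - 1)) v (A (i + 1)))"
    by (simp add: ear_def fun_eq_iff divide_inverse)
  then show ?thesis
    using affine_over_scale[OF affine_fun_orient(1)[of "A (i - 1)" "A (i + 1)"]] by simp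
qed

lemma ear_diagonal_ends [simp]: "ear A i (A (i - 1)) = 0" "ear A i (A (i + 1)) = 0"
  by (simp_all add: ear_def)

text \<open>Convexity as a strict side condition for each edge. Only the sign of \<open>s\<close>
  matters; fixing \<open>s\<close> itself lets all iterates share one locale instance
  parameter.\<close>

locale oriented_polygon =
  fixes n :: nat and s :: real and A :: polygon
  assumes n_ge_5: "n \<ge> 5"
    and periodic: "A (i + int n) = A i"
    and edge: "i + 1 < j \<Longrightarrow> j < i + int n \<Longrightarrow> s * orient (A i) (A (i + 1)) (A j) > 0"
begin

text \<open>Seen from \<open>A i\<close>, each step from \<open>A k\<close> to
  \<open>A (k + 1)\<close> turns the same way. All these vertices lie on one side of the edge
  leaving \<open>A i\<close>, which makes turning transitive.\<close>

lemma triple: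
  assumes "i < j" "j < k" "k < i + int n"
  shows "s * orient (A i) (A j) (A k) > 0"
proof -
  have step: "s * orient (A i) (A k) (A (k + 1)) > 0" if "i < k" "k + 1 < i + int n" for k
    using edge[of k "i + int n"] that by (simp add: periodic orient_rotate[of _ _ "A i"])
  have "j + 1 \<le> k" using assms by simp
  then have "k < i + int n \<longrightarrow> s * orient (A i) (A j) (A k) > 0"
  proof (induction k rule: int_ge_induct)
    case base
    then show ?case using step[of j] assms(1) by simp
  next
    case (step k)
    show ?case
    proof (cases "j = i + 1")
      case True
      then show ?thesis using edge[of i "k + 1"] step.hyps by simp
    next
      case False
      then have "i + 1 < j" using assms(1) by simp
      then show ?thesis
        using orient_transitive[of s "A i" "A (i + 1)" "A j" "A k" "A (k + 1)"]
          edge[of i j] edge[of i k] edge[of i "k + 1"] \<open>\<And>k. i < k \<Longrightarrow> k + 1 < i + int n \<Longrightarrow> s * orient (A i) (A k) (A (k + 1)) > 0\<close>[of k] step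
        by simp
    qed
  qed
  then show ?thesis using assms(3) by simp
qed

lemma triple_nonneg:
  assumes "i \<le> j" "j \<le> k" "k \<le> i + int n"
  shows "s * orient (A i) (A j) (A k) \<ge> 0"
proof (cases "i < j \<and> j < k \<and> k < i + int n")
  case True
  then show ?thesis using triple[of i j k] by simp
next
  case False
  then consider "j = i" | "k = j" | "k = i + int n" using assms by linarith
  then show ?thesis by cases (simp_all add: periodic)
qed

lemma ear_denominator: "s * orient (A (i - 1)) (A i) (A (i + 1)) > 0"
  using triple[of "i - 1" i "i + 1"] n_ge_5 by simp

lemma ear_self [simp]: "ear A i (A i) = 1"
  using ear_denominator[of i] by (auto simp: ear_def)

lemma ear_signed: "ear A i v = (s * orient (A (i - 1)) v (A (i + 1))) / (s * orient (A (i - 1)) (A i) (A (i + 1)))"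
  using ear_denominator[of i] by (auto simp: ear_def)

text \<open>The diagonal cutting off \<open>A i\<close> separates it from all other vertices, weakly
  because its own ends are included.\<close>

lemma ear_nonpos:
  assumes "i < j" "j < i + int n"
  shows "ear A i (A j) \<le> 0"
proof -
  have "s * orient (A (i - 1)) (A (i + 1)) (A j) \<ge> 0"
    by (rule triple_nonneg) (use assms in auto)
  then have "s * orient (A (i - 1)) (A j) (A (i + 1)) \<le> 0"
    by (simp add: orient_swap[of _ "A j"])
  then show ?thesis
    unfolding ear_signed using ear_denominator[of i] by (rule divide_nonpos_pos)
qed

lemma ear_periodic: "ear A (i + int n) = ear A i"
  using periodic[of "i - 1"] periodic[of "i + 1"] periodic[of i]
  by (simp add: ear_def fun_eq_iff algebra_simps)

lemma ear_sum_interval: "ear_sum n A g v = (\<Sum>i\<in>{a..<a + int n}. ear A i v * g (A i))"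
  unfolding ear_sum_def by (rule sum_periodic_interval[symmetric]) (simp add: ear_periodic periodic)

section \<open>The pentagram map on oriented polygons\<close>

lemma pentagram_vertex:
  obtains t u where "0 < t" "t < 1" "0 < u" "u < 1"
    "pentagram A i = (1 - t) *\<^sub>R A (i - 1) + t *\<^sub>R A (i + 1)"
    "pentagram A i = (1 - u) *\<^sub>R A i + u *\<^sub>R A (i + 2)"
proof -
  have pos: "s * orient (A (i - 1)) (A i) (A (i + 1)) > 0" "s * orient (A (i - 1)) (A i) (A (i + 2)) > 0"
    "s * orient (A (i - 1)) (A (i + 1)) (A (i + 2)) > 0" "s * orient (A i) (A (i + 1)) (A (i + 2)) > 0"
    using n_ge_5 by (auto intro!: triple)
  show ?thesis
    by (rule diagonals_meet[OF pos]) (rule that, auto simp: pentagram_def)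
qed

text \<open>The diagonal from \<open>A i\<close> to \<open>A (i + 2)\<close> carries two image
  vertices, the \<open>i\<close>-th at position \<open>u i\<close> and the next at
  \<open>t (i + 1)\<close>; the inequality gives their order.\<close>

lemma pentagram_coordinates:
  obtains t u where "\<And>i. 0 < t i" "\<And>i. t i < 1" "\<And>i. 0 < u i" "\<And>i. u i < 1" "\<And>i. u i < t (i + 1)"
    "\<And>i. pentagram A i = (1 - t i) *\<^sub>R A (i - 1) + t i *\<^sub>R A (i + 1)"
    "\<And>i. pentagram A i = (1 - u i) *\<^sub>R A i + u i *\<^sub>R A (i + 2)"
proof -
  have "\<exists>t u. 0 < t \<and> t < 1 \<and> 0 < u \<and> u < 1 \<and>
      pentagram A i = (1 - t) *\<^sub>R A (i - 1) + t *\<^sub>R A (i + 1) \<and>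
      pentagram A i = (1 - u) *\<^sub>R A i + u *\<^sub>R A (i + 2)" for i
    by (rule pentagram_vertex[of i]) blast
  then obtain t u where tu: "\<And>i. 0 < t i" "\<And>i. t i < 1" "\<And>i. 0 < u i" "\<And>i. u i < 1"
    and B: "\<And>i. pentagram A i = (1 - t i) *\<^sub>R A (i - 1) + t i *\<^sub>R A (i + 1)"
    and B': "\<And>i. pentagram A i = (1 - u i) *\<^sub>R A i + u i *\<^sub>R A (i + 2)"
    by metis
  have "u i < t (i + 1)" for i
  proof -
    \<comment> \<open>\<open>h\<close> decreases from \<open>A i\<close> to
      \<open>A (i + 2)\<close>, is 0 at the \<open>i\<close>-th image vertex and negative at the
      next one.\<close>
    define h where "h v = s * orient (A (i - 1)) v (A (i + 1))" for v
    have h: "affine_fun h"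
      unfolding h_def by (rule affine_over_scale[OF affine_fun_orient(1)]) auto
    note comb = affine_fun_convex_comb[OF h]
    have hA: "h (A i) > 0" "h (A (i + 2)) < 0" "h (A (i + 3)) < 0" "h (A (i + 1)) = 0" "h (A (i - 1)) = 0"
      using triple[of "i - 1" i "i + 1"] triple[of "i - 1" "i + 1" "i + 2"] triple[of "i - 1" "i + 1" "i + 3"] n_ge_5
      by (simp_all add: h_def orient_swap[of _ "A (i + 2)"] orient_swap[of _ "A (i + 3)"])
    have "h (pentagram A i) = 0"
      unfolding B comb using hA by simp
    then have at_i: "(1 - u i) * h (A i) + u i * h (A (i + 2)) = 0"
      unfolding B' comb by simp
    have "h (pentagram A (i + 1)) < 0"
      unfolding B' comb using hA(3,4) tu by (simp add: mult_pos_neg add.commute)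
    then have at_Suc_i: "(1 - t (i + 1)) * h (A i) + t (i + 1) * h (A (i + 2)) < 0"
      unfolding B comb by (simp add: add.commute)
    have "(t (i + 1) - u i) * (h (A i) - h (A (i + 2))) > 0"
      using at_i at_Suc_i by (simp add: algebra_simps)
    then show ?thesis
      using hA(1,2) by (simp add: zero_less_mult_iff)
  qed
  with tu B B' show ?thesis by (intro that)
qed

text \<open>An edge of the image lies on a short diagonal of \<open>A\<close> and points the same
  way, so its side condition is the one for that diagonal, scaled by
  \<open>t (i + 1) - u i\<close>.\<close>

lemma oriented_polygon_pentagram: "oriented_polygon n s (pentagram A)"
proof -
  obtain t u where tu: "\<And>i. 0 < t i" "\<And>i. t i < 1" "\<And>i. 0 < u i" "\<And>i. u i < 1" "\<And>i. u i < t (i + 1)"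
    and B: "\<And>i. pentagram A i = (1 - t i) *\<^sub>R A (i - 1) + t i *\<^sub>R A (i + 1)"
    and B': "\<And>i. pentagram A i = (1 - u i) *\<^sub>R A i + u i *\<^sub>R A (i + 2)"
    by (rule pentagram_coordinates) blast
  show ?thesis
  proof
    show "n \<ge> 5" by (rule n_ge_5)
    show "pentagram A (i + int n) = pentagram A i" for i
      by (rule pentagram_periodic) (rule periodic)
  next
    fix i j :: int assume ij: "i + 1 < j" "j < i + int n"
    define h where "h v = s * orient (A i) (A (i + 2)) v" for v
    have h: "affine_fun h"
      unfolding h_def by (rule affine_over_scale[OF affine_fun_orient(2)]) auto
    note comb = affine_fun_convex_comb[OF h]
    have nonneg: "h (A k) \<ge> 0" if "i + 2 \<le> k" "k \<le> i + int n" for k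
      unfolding h_def by (rule triple_nonneg) (use that in auto)
    have pos: "h (A k) > 0" if "i + 2 < k" "k < i + int n" for k
      unfolding h_def by (rule triple) (use that in auto)
    have hj: "h (pentagram A j) > 0"
    \<comment> \<open>This image vertex lies on the diagonal from \<open>A (i + 1)\<close>, which is
      on the wrong side. Its other diagonal is used, whose end \<open>A (i + 4)\<close> is strictly
      inside because \<open>n \<ge> 5\<close>.\<close>
    proof (cases "j = i + 2")
      case True
      then show ?thesis
        unfolding B' comb using pos[of "4 + i"] nonneg[of "i + 2"] n_ge_5 tu(3,4)[of j]
        by (simp add: add_pos_nonneg add.commute)
    next
      case False
      then have "i + 2 \<le> j - 1" "i + 2 < j - 1 \<or> j + 1 < i + int n"
        using ij n_ge_5 by linarith+
      then have "h (A (j - 1)) \<ge> 0" "h (A (j + 1)) \<ge> 0" "h (A (j - 1)) > 0 \<or> h (A (j + 1)) > 0"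
        using ij n_ge_5 nonneg[of "j - 1"] nonneg[of "j + 1"] pos[of "j - 1"] pos[of "j + 1"] by auto
      then show ?thesis
        unfolding B comb using tu(1,2)[of j] by (auto simp: add_nonneg_pos add_pos_nonneg)
    qed
    have "s * orient (pentagram A i) (pentagram A (i + 1)) v = (t (i + 1) - u i) * h v" for v
    proof -
      have next_vertex: "pentagram A (i + 1) = (1 - t (i + 1)) *\<^sub>R A i + t (i + 1) *\<^sub>R A (i + 2)"
        using B[of "i + 1"] by (simp add: add.commute)
      show ?thesis
        unfolding B'[of i] next_vertex h_def orient_def by (simp add: algebra_simps)
    qed
    then show "s * orient (pentagram A i) (pentagram A (i + 1)) (pentagram A j) > 0"
      using hj tu(5)[of i] by simp
  qed
qed

text \<open>With \<open>B\<close> the image polygon, \<open>A\<^sub>i\<^sub>-\<^sub>1 = p\<^sub>i B\<^sub>i + (1 - p\<^sub>i) B\<^sub>i\<^sub>-\<^sub>1\<close> because the three points lie on one diagonal, and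
  dually \<open>ear B i = p\<^sub>i ear A (i - 1) + (1 - p\<^sub>i\<^sub>+\<^sub>1) ear A i\<close>. Substituting the second identity and
  reindexing one of the two sums reassembles the first.\<close>
lemma ear_sum_pentagram:
  assumes g: "affine_fun g"
  shows "ear_sum n (pentagram A) g v = ear_sum n A g v"
proof -
  interpret B: oriented_polygon n s "pentagram A" by (rule oriented_polygon_pentagram)
  let ?B = "pentagram A"
  obtain t u where tu: "\<And>i. 0 < t i" "\<And>i. t i < 1" "\<And>i. 0 < u i" "\<And>i. u i < 1" "\<And>i. u i < t (i + 1)"
    and B: "\<And>i. ?B i = (1 - t i) *\<^sub>R A (i - 1) + t i *\<^sub>R A (i + 1)"
    and B': "\<And>i. ?B i = (1 - u i) *\<^sub>R A i + u i *\<^sub>R A (i + 2)"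
    by (rule pentagram_coordinates) blast
  note comb = affine_fun_convex_comb[OF affine_fun_ear]
  \<comment> \<open>Forced by applying \<open>ear A (i - 1)\<close> to \<open>A_comb\<close> below:
    it is 1 at \<open>A (i - 1)\<close> and 0 at \<open>?B (i - 1)\<close>.\<close>
  define p where "p i = 1 / ear A (i - 1) (?B i)" for i
  have ear_B: "ear A i (?B i) = 0" for i
    unfolding B comb by simp
  have ear_B': "ear A (i + 1) (?B i) = 0" for i
    unfolding B' comb using ear_diagonal_ends(1)[of A "i + 1"] ear_diagonal_ends(2)[of A "i + 1"]
    by (simp add: add.commute)
  \<comment> \<open>On the diagonal from \<open>A (i - 1)\<close> to \<open>A (i + 1)\<close>, the
    points \<open>?B (i - 1)\<close> and \<open>?B i\<close> have positions \<open>u (i - 1)\<close>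
    and \<open>t i\<close>; the equation says that the combination has position 0.\<close>
  have p: "ear A (i - 1) (?B i) \<noteq> 0 \<and> p i * t i + (1 - p i) * u (i - 1) = 0" for i
  proof -
    let ?e = "ear A (i - 1) (A (i + 1))"
    have u: "u (i - 1) > 0" "u (i - 1) < t i"
      using tu(3)[of "i - 1"] tu(5)[of "i - 1"] by simp_all
    have "?B (i - 1) = (1 - u (i - 1)) *\<^sub>R A (i - 1) + u (i - 1) *\<^sub>R A (i + 1)"
      using B'[of "i - 1"] by (simp add: add.commute)
    then have "0 = (1 - u (i - 1)) + u (i - 1) * ?e"
      using ear_B[of "i - 1"] by (simp add: comb)
    then have ue: "u (i - 1) * ?e = u (i - 1) - 1" by simp
    have "u (i - 1) * ear A (i - 1) (?B i) = u (i - 1) * (1 - t i) + t i * (u (i - 1) * ?e)"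
      unfolding B[of i] comb by (simp add: distrib_left)
    also have "\<dots> = u (i - 1) - t i"
      unfolding ue by (simp add: algebra_simps)
    finally have e: "ear A (i - 1) (?B i) = (u (i - 1) - t i) / u (i - 1)"
      using u by (simp add: eq_divide_eq mult.commute)
    show ?thesis
      unfolding p_def e using u by (simp add: divide_simps)
  qed
  have A_comb: "A (i - 1) = (1 - p i) *\<^sub>R ?B (i - 1) + p i *\<^sub>R ?B i" for i
  proof -
    have prev: "?B (i - 1) = (1 - u (i - 1)) *\<^sub>R A (i - 1) + u (i - 1) *\<^sub>R A (i + 1)"
      using B'[of "i - 1"] by (simp add: add.commute)
    have "(1 - p i) *\<^sub>R ?B (i - 1) + p i *\<^sub>R ?B i
        = A (i - 1) + (p i * t i + (1 - p i) * u (i - 1)) *\<^sub>R (A (i + 1) - A (i - 1))"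
      unfolding B[of i] prev by (simp add: algebra_simps)
    then show ?thesis using p[of i] by simp
  qed
  have ear_eq: "ear ?B i v = p i * ear A (i - 1) v + (1 - p (i + 1)) * ear A i v" for i
  proof -
    \<comment> \<open>An affine function is determined by its values at three noncollinear points.
      Here \<open>f\<close> takes the values 0, 1, 0 of \<open>ear ?B i\<close> at three consecutive
      vertices of \<open>?B\<close>.\<close>
    define f where "f v = p i * ear A (i - 1) v + (1 - p (i + 1)) * ear A i v" for v
    have f: "affine_fun f"
      unfolding f_def by (intro affine_over_add affine_over_scale affine_fun_ear) auto
    have "f (?B (i - 1)) = 0"
      using ear_B[of "i - 1"] ear_B'[of "i - 1"] by (simp add: f_def)
    moreover have "f (?B i) = 1"
      using ear_B[of i] p[of i] by (simp add: f_def p_def)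
    moreover have "f (?B (i + 1)) = 0"
    proof -
      have "0 = ear A (i - 1) (A i)"
        using ear_diagonal_ends(2)[of A "i - 1"] by simp
      also have "\<dots> = (1 - p (i + 1)) * ear A (i - 1) (?B i) + p (i + 1) * ear A (i - 1) (?B (i + 1))"
        using A_comb[of "i + 1"] comb[of A "i - 1"] by (metis add_diff_cancel_right')
      finally have left: "p (i + 1) * ear A (i - 1) (?B (i + 1)) = (p (i + 1) - 1) / p i"
        using p[of i] by (simp add: p_def algebra_simps)
      have nonzero: "p i \<noteq> 0" "p (i + 1) \<noteq> 0" and right: "ear A i (?B (i + 1)) * p (i + 1) = 1"
        using p[of i] p[of "i + 1"] by (simp_all add: p_def)
      have "f (?B (i + 1)) * p (i + 1)
          = p i * (p (i + 1) * ear A (i - 1) (?B (i + 1))) + (1 - p (i + 1)) * (ear A i (?B (i + 1)) * p (i + 1))"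
        by (simp add: f_def algebra_simps)
      also have "\<dots> = 0"
        unfolding left right using nonzero by simp
      finally show ?thesis using nonzero by simp
    qed
    ultimately have "f v * orient (?B (i - 1)) (?B i) (?B (i + 1)) = orient (?B (i - 1)) v (?B (i + 1))"
      using affine_fun_barycentric[OF f, of v "?B (i - 1)" "?B i" "?B (i + 1)"] by simp
    moreover have "orient (?B (i - 1)) (?B i) (?B (i + 1)) \<noteq> 0"
      using B.ear_denominator[of i] by auto
    ultimately have "ear ?B i v = f v"
      by (simp add: ear_def[of ?B] divide_eq_eq)
    then show ?thesis by (simp add: f_def)
  qed
  have p_periodic: "p (i + int n) = p i" for i
    using ear_periodic[of "i - 1"] B.periodic[of i] by (simp add: p_def algebra_simps)
  have per: "ear A (i + int n - 1) = ear A (i - 1)" "A (i + int n - 1) = A (i - 1)" "?B (i + int n - 1) = ?B (i - 1)" for i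
    using ear_periodic[of "i - 1"] periodic[of "i - 1"] B.periodic[of "i - 1"] by (simp_all add: algebra_simps)
  let ?h = "\<lambda>i. (1 - p i) * ear A (i - 1) v * g (?B (i - 1))"
  have "ear_sum n ?B g v = (\<Sum>i\<in>{0..<int n}. p i * ear A (i - 1) v * g (?B i)) + (\<Sum>i\<in>{0..<int n}. ?h (i + 1))"
    unfolding ear_sum_def ear_eq by (simp add: algebra_simps flip: sum.distrib)
  also have "(\<Sum>i\<in>{0..<int n}. ?h (i + 1)) = (\<Sum>i\<in>{0..<int n}. ?h i)"
    by (rule sum_periodic_shift) (simp only: p_periodic per)
  also have "(\<Sum>i\<in>{0..<int n}. p i * ear A (i - 1) v * g (?B i)) + \<dots>
      = (\<Sum>i\<in>{0..<int n}. ear A (i - 1) v * ((1 - p i) * g (?B (i - 1)) + p i * g (?B i)))"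
    by (simp add: algebra_simps flip: sum.distrib)
  also have "\<dots> = (\<Sum>i\<in>{0..<int n}. ear A (i - 1) v * g (A (i - 1)))"
    by (simp only: A_comb[symmetric] flip: affine_fun_convex_comb[OF g])
  also have "\<dots> = ear_sum n A g v"
    unfolding ear_sum_def using sum_periodic_shift[of "\<lambda>i. ear A i v * g (A i)" n "- 1"]
    by (simp add: ear_periodic periodic)
  finally show ?thesis .
qed

text \<open>An image vertex lies on two short diagonals of \<open>A\<close>. At least one of them
  avoids \<open>A i\<close>, and \<open>ear A i\<close> is nonpositive at both of its ends.\<close>

lemma ear_pentagram_nonpos: "ear A i (pentagram A j) \<le> 0"
proof -
  obtain t u where tu: "\<And>i. 0 < t i" "\<And>i. t i < 1" "\<And>i. 0 < u i" "\<And>i. u i < 1" "\<And>i. u i < t (i + 1)"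
    and B: "\<And>i. pentagram A i = (1 - t i) *\<^sub>R A (i - 1) + t i *\<^sub>R A (i + 1)"
    and B': "\<And>i. pentagram A i = (1 - u i) *\<^sub>R A i + u i *\<^sub>R A (i + 2)"
    by (rule pentagram_coordinates) blast
  note comb = affine_fun_convex_comb[OF affine_fun_ear]
  have "pentagram A (i + int n) = pentagram A i" for i
    by (rule pentagram_periodic) (rule periodic)
  then obtain k where k: "k \<in> {i..<i + int n}" and jk: "pentagram A k = pentagram A j"
    by (rule periodic_representative[of "pentagram A" n i j]) (use n_ge_5 in auto)
  have nonpos: "(1 - x) * a + x * b \<le> 0" if "0 < x" "x < 1" "a \<le> 0" "b \<le> 0" for a b x :: real
    using that by (intro add_nonpos_nonpos mult_nonneg_nonpos) auto
  consider "k = i" | "k = i + 1" | "k = i + int n - 1" | "i + 1 < k" "k < i + int n - 1"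
    using k by force
  then have "ear A i (pentagram A k) \<le> 0"
  proof cases
    case 1
    then show ?thesis unfolding B comb by simp
  next
    case 2
    then show ?thesis unfolding B' comb
      using n_ge_5 tu(3,4)[of k] by (intro nonpos ear_nonpos) auto
  next
    case 3
    have "A k = A (i - 1)" "A (k + 2) = A (i + 1)"
      using periodic[of "i - 1"] periodic[of "i + 1"] by (simp_all add: 3 algebra_simps)
    then show ?thesis unfolding B' comb by simp
  next
    case 4
    then show ?thesis unfolding B comb
      using tu(1,2)[of k] by (intro nonpos ear_nonpos) auto
  qed
  then show ?thesis by (simp add: jk)
qed

lemma pentagram_in_hull: "range (pentagram A) \<subseteq> convex hull (range A)"
proof
  fix v assume "v \<in> range (pentagram A)"
  then obtain i where v: "v = pentagram A i" by blast
  obtain t u where "0 < t" "t < 1" "pentagram A i = (1 - t) *\<^sub>R A (i - 1) + t *\<^sub>R A (i + 1)"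
    by (rule pentagram_vertex[of i]) blast
  then show "v \<in> convex hull (range A)"
    unfolding v using convexD_alt[OF convex_convex_hull[of "range A"], of "A (i - 1)" "A (i + 1)" t]
    by (simp add: hull_inc)
qed

section \<open>Uniqueness of the eigenpoint\<close>

lemma line_meets_edge:
  assumes f: "affine_fun f" and P: "P \<in> convex hull (range A)" "f P = 0"
  obtains j r where "0 \<le> r" "r \<le> 1" "f ((1 - r) *\<^sub>R A j + r *\<^sub>R A (j + 1)) = 0"
proof -
  have not_all_pos: "\<not> (\<forall>i. g (A i) > 0)" if g: "affine_fun g" "g P = 0" for g
  proof
    assume "\<forall>i. g (A i) > 0"
    then have "convex hull (range A) \<subseteq> {v. g v > 0}"
      by (intro hull_minimal affine_fun_convex_sets(2)[OF g(1)]) auto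
    then show False using P(1) g(2) by auto
  qed
  obtain a where a: "f (A a) \<le> 0"
    using not_all_pos[OF f P(2)] by (auto simp: not_less)
  have "affine_fun (\<lambda>v. - 1 * f v)"
    by (rule affine_over_scale[OF f]) auto
  then obtain b where b: "f (A b) \<ge> 0"
    using not_all_pos[of "\<lambda>v. - 1 * f v"] P(2) by (auto simp: not_less)
  \<comment> \<open>The window starts at \<open>a + 1\<close>, so a vertex of nonnegative value is
    met after \<open>A a\<close>.\<close>
  obtain c where c: "c \<in> {a + 1..<a + 1 + int n}" "A c = A b"
    by (rule periodic_representative[of A n "a + 1" b, OF periodic]) (use n_ge_5 in auto)
  \<comment> \<open>Discrete intermediate value argument: without a sign change the value would stay
    negative all the way to \<open>A c\<close>.\<close>
  have "\<exists>j. f (A j) \<le> 0 \<and> f (A (j + 1)) \<ge> 0"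
  proof (rule ccontr)
    assume none: "\<not> ?thesis"
    have step: "f (A (i + 1)) < 0" if "f (A i) \<le> 0" for i
      using none that by (meson not_le)
    have "a + 1 \<le> c" using c by simp
    then have "f (A c) < 0"
    proof (induction c rule: int_ge_induct)
      case base
      then show ?case using step[OF a] .
    next
      case (step i)
      then show ?case using \<open>\<And>i. f (A i) \<le> 0 \<Longrightarrow> f (A (i + 1)) < 0\<close>[of i] by simp
    qed
    then show False using b c(2) by simp
  qed
  then obtain j where j: "f (A j) \<le> 0" "f (A (j + 1)) \<ge> 0" by blast
  show ?thesis
  proof (cases "f (A (j + 1)) = f (A j)")
    case True
    then show ?thesis using that[of 0 j] j by simp
  next
    case False
    define r where "r = - f (A j) / (f (A (j + 1)) - f (A j))"
    have "0 \<le> r" "r \<le> 1" "f ((1 - r) *\<^sub>R A j + r *\<^sub>R A (j + 1)) = 0"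
      using j False unfolding affine_fun_convex_comb[OF f] r_def by (auto simp: field_simps)
    then show ?thesis by (rule that)
  qed
qed

text \<open>For \<open>v\<close> on an edge the defect of the eigenvector equation points strictly into the polygon,
  unless the eigenvalue is 1.\<close>
lemma no_eigenpoint_on_edge:
  assumes eigen: "\<And>g. affine_fun g \<Longrightarrow> ear_sum n A g v = \<mu> * g v" and "\<mu> \<le> 0"
    and r: "0 \<le> r" "r \<le> 1" and v: "v = (1 - r) *\<^sub>R A j + r *\<^sub>R A (j + 1)"
  shows False
proof -
  have sum_split: "ear_sum n A g v
      = ear A j v * g (A j) + ear A (j + 1) v * g (A (j + 1)) + (\<Sum>i\<in>{j + 2..<j + int n}. ear A i v * g (A i))" for g
  proof -
    have "{j..<j + int n} = insert j (insert (j + 1) {j + 2..<j + int n})"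
      using n_ge_5 by auto
    then show ?thesis
      unfolding ear_sum_interval[of _ _ j] by (simp add: add.assoc)
  qed
  have v_ear: "ear A i v \<le> 0" if "j + 1 < i" "i < j + int n" for i
  proof -
    \<comment> \<open>The ends of the edge are indexed one period later, so that they follow
      \<open>i\<close>.\<close>
    have "ear A i (A (j + int n)) \<le> 0" "ear A i (A (j + 1 + int n)) \<le> 0"
      by (rule ear_nonpos; use that in simp)+
    then show ?thesis
      unfolding v affine_fun_convex_comb[OF affine_fun_ear] periodic
      using r by (intro add_nonpos_nonpos mult_nonneg_nonpos) auto
  qed
  define h where "h w = s * orient (A j) (A (j + 1)) w" for w
  have h: "affine_fun h"
    unfolding h_def by (rule affine_over_scale[OF affine_fun_orient(2)]) auto
  have h0: "h (A j) = 0" "h (A (j + 1)) = 0" "h v = 0"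
    unfolding v affine_fun_convex_comb[OF h] by (simp_all add: h_def)
  have h_pos: "h (A i) > 0" if "j + 1 < i" "i < j + int n" for i
    unfolding h_def using that by (rule edge)
  \<comment> \<open>The eigenvector equation for \<open>h\<close> is a vanishing sum of nonnegative
    terms, so every weight off the edge is 0.\<close>
  have "(\<Sum>i\<in>{j + 2..<j + int n}. - ear A i v * h (A i)) = 0"
    using eigen[OF h] sum_split[of h] h0 by (simp add: sum_negf)
  moreover have "- ear A i v * h (A i) \<ge> 0" if "i \<in> {j + 2..<j + int n}" for i
    using v_ear[of i] h_pos[of i] that by (simp add: mult_nonpos_nonneg)
  ultimately have zero: "\<forall>i\<in>{j + 2..<j + int n}. - ear A i v * h (A i) = 0"
    using sum_nonneg_eq_0_iff[of "{j + 2..<j + int n}" "\<lambda>i. - ear A i v * h (A i)"] by blast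
  have "ear A i v = 0" if "i \<in> {j + 2..<j + int n}" for i
    using bspec[OF zero that] h_pos[of i] that by simp
  then have "\<mu> = ear A j v + ear A (j + 1) v"
    using eigen[OF affine_fun_const[of 1]] sum_split[of "\<lambda>_. 1"] by simp
  also have "\<dots> = 1"
    unfolding v affine_fun_convex_comb[OF affine_fun_ear] using ear_diagonal_ends(1)[of A "j + 1"] by simp
  finally show False using \<open>\<mu> \<le> 0\<close> by simp
qed

text \<open>Two eigenpoints would make their whole line consist of eigenpoints, and a line through a
  point of the hull meets an edge.\<close>

lemma eigenpoint_unique:
  assumes P: "P \<in> convex hull (range A)" and "\<mu> \<le> 0"
    and eigen_P: "\<And>g. affine_fun g \<Longrightarrow> ear_sum n A g P = \<mu> * g P"
    and eigen_Q: "\<And>g. affine_fun g \<Longrightarrow> ear_sum n A g Q = \<mu> * g Q"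
  shows "Q = P"
proof (rule ccontr)
  assume "Q \<noteq> P"
  have f: "affine_fun (\<lambda>v. orient P Q v)" by (rule affine_fun_orient(2))
  obtain j r where r: "0 \<le> r" "r \<le> 1" and on_line: "orient P Q ((1 - r) *\<^sub>R A j + r *\<^sub>R A (j + 1)) = 0"
    by (rule line_meets_edge[OF f P]) auto
  define v where "v = (1 - r) *\<^sub>R A j + r *\<^sub>R A (j + 1)"
  obtain x where x: "v = (1 - x) *\<^sub>R P + x *\<^sub>R Q"
    by (rule orient_zero_imp_line[OF on_line[folded v_def]]) (use \<open>Q \<noteq> P\<close> in auto)
  have "ear_sum n A g v = \<mu> * g v" if g: "affine_fun g" for g
  proof -
    have "ear_sum n A g v = (1 - x) * ear_sum n A g P + x * ear_sum n A g Q"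
      unfolding ear_sum_def x affine_fun_convex_comb[OF affine_fun_ear]
      by (simp add: sum_distrib_left algebra_simps flip: sum.distrib)
    also have "\<dots> = \<mu> * ((1 - x) * g P + x * g Q)"
      unfolding eigen_P[OF g] eigen_Q[OF g] by (simp add: algebra_simps)
    finally show ?thesis unfolding x affine_fun_convex_comb[OF g] .
  qed
  then show False
    using no_eigenpoint_on_edge[OF _ \<open>\<mu> \<le> 0\<close> r v_def] by blast
qed

end

section \<open>The limit point\<close>

lemma oriented_polygon_iterate:
  assumes "oriented_polygon n s A"
  shows "oriented_polygon n s ((pentagram ^^ k) A)"
  using assms by (induction k) (auto intro: oriented_polygon.oriented_polygon_pentagram)

lemma ear_sum_iterate:
  assumes "oriented_polygon n s A" "affine_fun g"
  shows "ear_sum n ((pentagram ^^ k) A) g v = ear_sum n A g v"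
proof (induction k)
  case (Suc k)
  then show ?case
    using oriented_polygon.ear_sum_pentagram[OF oriented_polygon_iterate[OF assms(1), of k] assms(2)] by simp
qed simp

lemma iterate_in_convex:
  assumes A: "oriented_polygon n s A" and C: "convex C" "range ((pentagram ^^ m) A) \<subseteq> C"
  shows "range ((pentagram ^^ (k + m)) A) \<subseteq> C"
proof (induction k)
  case 0
  then show ?case using C by simp
next
  case (Suc k)
  have "range (pentagram ((pentagram ^^ (k + m)) A)) \<subseteq> convex hull (range ((pentagram ^^ (k + m)) A))"
    by (rule oriented_polygon.pentagram_in_hull[OF oriented_polygon_iterate[OF A]])
  also have "\<dots> \<subseteq> C"
    using Suc C(1) by (rule hull_minimal)
  finally show ?case by simp
qed

lemma pentagram_limit_iterate:
  assumes "pentagram_limit A P"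
  shows "pentagram_limit ((pentagram ^^ m) A) P"
  unfolding pentagram_limit_def
proof
  fix i
  have "(\<lambda>k. (pentagram ^^ k) A i) \<longlonglongrightarrow> P"
    using assms unfolding pentagram_limit_def by blast
  then have "(\<lambda>k. (pentagram ^^ (k + m)) A i) \<longlonglongrightarrow> P"
    by (rule LIMSEQ_ignore_initial_segment)
  then show "(\<lambda>k. (pentagram ^^ k) ((pentagram ^^ m) A) i) \<longlonglongrightarrow> P"
    by (simp add: funpow_add)
qed

text \<open>The start index \<open>m\<close> allows half-planes that contain the first iterate but
  not \<open>A\<close> itself, such as those bounded by the ear diagonals.\<close>

lemma pentagram_limit_in_closed_convex:
  assumes A: "oriented_polygon n s A" and P: "pentagram_limit A P"
    and C: "closed C" "convex C" "range ((pentagram ^^ m) A) \<subseteq> C"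
  shows "P \<in> C"
proof (rule closed_sequentially[OF C(1)])
  have "pentagram_limit ((pentagram ^^ m) A) P"
    using P by (rule pentagram_limit_iterate)
  then show "(\<lambda>k. (pentagram ^^ (k + m)) A 0) \<longlonglongrightarrow> P"
    by (simp add: pentagram_limit_def funpow_add)
  show "(pentagram ^^ (k + m)) A 0 \<in> C" for k
    using iterate_in_convex[OF A C(2,3), of k] by blast
qed

lemma ear_pentagram_limit_nonpos:
  assumes A: "oriented_polygon n s A" and P: "pentagram_limit A P"
  shows "ear A i P \<le> 0"
proof -
  have "range ((pentagram ^^ 1) A) \<subseteq> {v. ear A i v \<le> 0}"
    using oriented_polygon.ear_pentagram_nonpos[OF A] by auto
  then have "P \<in> {v. ear A i v \<le> 0}"
    by (rule pentagram_limit_in_closed_convex[OF A P affine_fun_convex_sets(3,1)[OF affine_fun_ear]])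
  then show ?thesis by simp
qed

lemma pentagram_limit_in_hull:
  assumes A: "oriented_polygon n s A" and P: "pentagram_limit A P"
  shows "P \<in> convex hull (range A)"
proof (rule pentagram_limit_in_closed_convex[OF A P])
  show "closed (convex hull (range A))"
    using oriented_polygon.periodic[OF A] oriented_polygon.n_ge_5[OF A]
    by (intro compact_imp_closed finite_imp_compact_convex_hull periodic_finite_range[of A n]) auto
  show "range ((pentagram ^^ 0) A) \<subseteq> convex hull (range A)"
    by (simp add: hull_subset)
qed (rule convex_convex_hull)

text \<open>In the \<open>k\<close>-th polygon the defect is \<open>\<Sum>\<^sub>i ear\<^sub>i(P) (g(A\<^sub>i) - g(P))\<close>; the weights all have the
  same sign and a sum independent of \<open>k\<close>, while the vertices tend to \<open>P\<close>.\<close>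
lemma pentagram_limit_eigenpoint:
  assumes A: "oriented_polygon n s A" and P: "pentagram_limit A P" and g: "affine_fun g"
  shows "ear_sum n A g P = ear_sum n A (\<lambda>_. 1) P * g P"
proof -
  let ?A = "\<lambda>k. (pentagram ^^ k) A"
  define \<mu> where "\<mu> = ear_sum n A (\<lambda>_. 1) P"
  define c where "c = ear_sum n A g P - \<mu> * g P"
  have \<mu>_sum: "(\<Sum>i\<in>{0..<int n}. ear (?A k) i P) = \<mu>" for k
    using ear_sum_iterate[OF A affine_fun_const[of 1], of k P] by (simp add: \<mu>_def ear_sum_def)
  have nonpos: "ear (?A k) i P \<le> 0" for k i
    by (rule ear_pentagram_limit_nonpos[OF oriented_polygon_iterate[OF A] pentagram_limit_iterate[OF P]])
  \<comment> \<open>Uniform in \<open>k\<close>, although the denominators of the ears tend to 0: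
    terms of one sign are dominated by their sum.\<close>
  have bound: "\<bar>ear (?A k) i P\<bar> \<le> \<bar>\<mu>\<bar>" if "i \<in> {0..<int n}" for k i
  proof -
    have "- ear (?A k) i P \<le> (\<Sum>i\<in>{0..<int n}. - ear (?A k) i P)"
      using nonpos by (intro member_le_sum that) auto
    then show ?thesis
      using nonpos[of k i] \<mu>_sum[of k] by (simp add: sum_negf)
  qed
  have c_bound: "\<bar>c\<bar> \<le> (\<Sum>i\<in>{0..<int n}. \<bar>\<mu>\<bar> * \<bar>g (?A k i) - g P\<bar>)" for k
  proof -
    have "c = ear_sum n (?A k) g P - (\<Sum>i\<in>{0..<int n}. ear (?A k) i P) * g P"
      unfolding c_def \<mu>_sum ear_sum_iterate[OF A g] ..
    also have "\<dots> = (\<Sum>i\<in>{0..<int n}. ear (?A k) i P * (g (?A k i) - g P))"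
      unfolding ear_sum_def by (simp add: sum_distrib_right right_diff_distrib sum_subtractf)
    also have "\<bar>\<dots>\<bar> \<le> (\<Sum>i\<in>{0..<int n}. \<bar>ear (?A k) i P * (g (?A k i) - g P)\<bar>)"
      by (rule sum_abs)
    also have "\<dots> \<le> (\<Sum>i\<in>{0..<int n}. \<bar>\<mu>\<bar> * \<bar>g (?A k i) - g P\<bar>)"
      unfolding abs_mult using bound by (intro sum_mono mult_right_mono) auto
    finally show ?thesis .
  qed
  have lim: "(\<lambda>k. g (?A k i)) \<longlonglongrightarrow> g P" for i
  proof -
    obtain a b d where gv: "\<And>v. g v = a + b * fst v + d * snd v"
      using g unfolding affine_over_def by blast
    have "(\<lambda>k. ?A k i) \<longlonglongrightarrow> P"
      using P unfolding pentagram_limit_def by blast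
    then show ?thesis
      unfolding gv by (intro tendsto_intros)
  qed
  have "(\<lambda>k. \<Sum>i\<in>{0..<int n}. \<bar>\<mu>\<bar> * \<bar>g (?A k i) - g P\<bar>) \<longlonglongrightarrow> (\<Sum>i\<in>{0..<int n}. \<bar>\<mu>\<bar> * \<bar>g P - g P\<bar>)"
    by (intro tendsto_intros lim)
  then have "\<bar>c\<bar> \<le> (\<Sum>i\<in>{0..<int n}. \<bar>\<mu>\<bar> * \<bar>g P - g P\<bar>)"
    by (rule LIMSEQ_le_const) (use c_bound in blast)
  then show ?thesis by (simp add: c_def \<mu>_def)
qed

section \<open>Supporting lines and the orientation of a convex polygon\<close>

lemma collinear_if_orient_zero:
  assumes "orient P Q R = 0"
  shows "collinear {P, Q, R}"
proof (cases "P = Q")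
  case False
  then show ?thesis
    using orient_zero_imp_line[OF assms] by (metis collinear_3_affine_hull line_iff)
qed simp

text \<open>\<open>Q - P\<close> is orthogonal to \<open>a\<close>, so orientation against
  \<open>PQ\<close> is proportional to the offset from the line. The constant \<open>c\<close> is
  the cross product of \<open>a\<close> with \<open>Q - P\<close>.\<close>

lemma orient_supporting_line:
  assumes PQ: "inner a P = b" "inner a Q = b"
  obtains c where "\<And>R. inner a a * orient P Q R = c * (b - inner a R)"
proof
  let ?c = "fst a * (snd Q - snd P) - snd a * (fst Q - fst P)"
  fix R
  have b: "b = fst a * fst P + snd a * snd P" and perp: "fst a * (fst Q - fst P) + snd a * (snd Q - snd P) = 0"
    using PQ by (simp_all add: inner_prod_def algebra_simps)
  show "inner a a * orient P Q R = ?c * (b - inner a R)"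
  proof -
    have "inner a a * orient P Q R = ?c * (b - inner a R)
        + (fst a * (fst Q - fst P) + snd a * (snd Q - snd P)) * (fst a * (snd R - snd P) - snd a * (fst R - fst P))"
      unfolding b orient_def inner_prod_def inner_real_def by (simp add: algebra_simps)
    then show ?thesis unfolding perp by simp
  qed
qed

lemma convex_polygonD:
  assumes "convex_polygon n A"
  shows "A (i + int n) = A i"
    and "closed_segment (A i) (A (i + 1)) edge_of (convex hull (range A))"
    and "i \<in> {1..int n} \<Longrightarrow> j \<in> {1..int n} \<Longrightarrow> k \<in> {1..int n} \<Longrightarrow>
      i \<noteq> j \<Longrightarrow> j \<noteq> k \<Longrightarrow> i \<noteq> k \<Longrightarrow> \<not> collinear {A i, A j, A k}"
proof -
  note conjs = assms[unfolded convex_polygon_def]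
  show "A (i + int n) = A i"
    using conjunct1[OF conjs] by (rule spec)
  show "closed_segment (A i) (A (i + 1)) edge_of (convex hull (range A))"
    using conjunct1[OF conjunct2[OF conjunct2[OF conjunct2[OF conjs]]]] by (rule spec)
  show "i \<in> {1..int n} \<Longrightarrow> j \<in> {1..int n} \<Longrightarrow> k \<in> {1..int n} \<Longrightarrow>
      i \<noteq> j \<Longrightarrow> j \<noteq> k \<Longrightarrow> i \<noteq> k \<Longrightarrow> \<not> collinear {A i, A j, A k}"
    using conjunct2[OF conjunct2[OF conjunct2[OF conjunct2[OF conjs]]]] by blast
qed

lemma convex_polygon_distinct_triple:
  assumes A: "convex_polygon n A" and ijk: "i < j" "j < k" "k < i + int n"
  shows "orient (A i) (A j) (A k) \<noteq> 0"
proof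
  assume zero: "orient (A i) (A j) (A k) = 0"
  have n: "n > 0" using ijk by linarith
  have per: "A (i + int n) = A i" for i
    by (rule convex_polygonD(1)[OF A])
  \<comment> \<open>The representative modulo \<open>n\<close> in \<open>{1..int n}\<close>, the
    index range in which noncollinearity is given.\<close>
  define r where "r i = 1 + (i - 1) mod int n" for i
  have A_r: "A (r i) = A i" for i
  proof -
    have "r i + (i - 1) div int n * int n = i"
      using mod_div_mult_eq[of "i - 1" "int n"] unfolding r_def by linarith
    then have "A i = A (r i + (i - 1) div int n * int n)"
      by (simp only:)
    also have "\<dots> = A (r i)"
      by (rule periodic_add_multiple) (rule per)
    finally show ?thesis ..
  qed
  have r_range: "r i \<in> {1..int n}" for i
  proof -
    have "0 \<le> (i - 1) mod int n" "(i - 1) mod int n < int n" using n by simp_all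
    then show ?thesis unfolding r_def by simp
  qed
  have r_neq: "r x \<noteq> r y" if "x < y" "y < x + int n" for x y
  proof
    assume "r x = r y"
    then have "(y - 1) mod int n = (x - 1) mod int n"
      unfolding r_def by linarith
    then have "int n dvd (y - 1) - (x - 1)"
      by (simp only: mod_eq_dvd_iff)
    then have "int n \<le> (y - 1) - (x - 1)"
      using that(1) by (intro zdvd_imp_le) auto
    then show False using that(2) by simp
  qed
  have "r i \<noteq> r j" "r j \<noteq> r k" "r i \<noteq> r k"
    by (rule r_neq; use ijk in linarith)+
  then have "\<not> collinear {A (r i), A (r j), A (r k)}"
    by (intro convex_polygonD(3)[OF A] r_range)
  then show False
    using collinear_if_orient_zero[OF zero] by (simp add: A_r)
qed

text \<open>The supporting line exists because faces of polyhedra are exposed.\<close>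
lemma convex_polygon_edge_side:
  assumes A: "convex_polygon n A"
    and j: "i + 1 < j" "j < i + int n" and k: "i + 1 < k" "k < i + int n"
  shows "orient (A i) (A (i + 1)) (A j) * orient (A i) (A (i + 1)) (A k) > 0"
proof -
  let ?H = "convex hull (range A)"
  have per: "A (i + int n) = A i" for i
    by (rule convex_polygonD(1)[OF A])
  have "finite (range A)"
    by (rule periodic_finite_range[of A n, OF per]) (use j in auto)
  then have "polyhedron ?H"
    by (intro polytope_imp_polyhedron) (auto simp: polytope_def)
  moreover have "closed_segment (A i) (A (i + 1)) face_of ?H"
    using convex_polygonD(2)[OF A] unfolding edge_of_def by blast
  ultimately have "closed_segment (A i) (A (i + 1)) exposed_face_of ?H"
    by (simp add: exposed_face_of_polyhedron)
  then obtain a b where H: "?H \<subseteq> {x. inner a x \<le> b}"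
    and seg: "closed_segment (A i) (A (i + 1)) = ?H \<inter> {x. inner a x = b}"
    unfolding exposed_face_of_def by blast
  have "A i \<in> closed_segment (A i) (A (i + 1))" "A (i + 1) \<in> closed_segment (A i) (A (i + 1))"
    by simp_all
  then have ends: "inner a (A i) = b" "inner a (A (i + 1)) = b"
    unfolding seg by blast+
  obtain c where c: "\<And>v. inner a a * orient (A i) (A (i + 1)) v = c * (b - inner a v)"
    by (rule orient_supporting_line[OF ends]) blast
  \<comment> \<open>A further vertex on the supporting line would lie in the face, hence on the
    edge, and be collinear with its ends.\<close>
  have below: "inner a (A l) < b \<and> orient (A i) (A (i + 1)) (A l) \<noteq> 0" if l: "i + 1 < l" "l < i + int n" for l
  proof -
    have nz: "orient (A i) (A (i + 1)) (A l) \<noteq> 0"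
      by (rule convex_polygon_distinct_triple[OF A]) (use l in auto)
    have Al: "A l \<in> ?H" by (simp add: hull_inc)
    have "inner a (A l) \<noteq> b"
    proof
      assume "inner a (A l) = b"
      then have "A l \<in> closed_segment (A i) (A (i + 1))"
        using Al seg by blast
      then obtain x where "A l = (1 - x) *\<^sub>R A i + x *\<^sub>R A (i + 1)"
        unfolding in_segment by blast
      then have "orient (A i) (A (i + 1)) (A l) = 0"
        by (simp add: affine_fun_convex_comb[OF affine_fun_orient(2)])
      with nz show False ..
    qed
    then show ?thesis using Al H nz by force
  qed
  have aa: "inner a a > 0"
    using below[OF j] ends(1) by auto
  have "(inner a a * orient (A i) (A (i + 1)) (A j)) * (inner a a * orient (A i) (A (i + 1)) (A k)) > 0"
  proof -
    have "c \<noteq> 0" using c[of "A j"] below[OF j] aa by auto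
    then have "c * c > 0" using not_real_square_gt_zero[of c] by blast
    then have "(c * c) * ((b - inner a (A j)) * (b - inner a (A k))) > 0"
      using below[OF j] below[OF k] by (intro mult_pos_pos[OF _ mult_pos_pos]) simp_all
    moreover have "(c * (b - inner a (A j))) * (c * (b - inner a (A k)))
        = (c * c) * ((b - inner a (A j)) * (b - inner a (A k)))" by simp
    ultimately show ?thesis
      unfolding c by (simp only:)
  qed
  then have "(inner a a * inner a a) * (orient (A i) (A (i + 1)) (A j) * orient (A i) (A (i + 1)) (A k)) > 0"
    by (simp only: ac_simps)
  then show ?thesis
    by (rule zero_less_mult_pos) (rule mult_pos_pos[OF aa aa])
qed

text \<open>Each edge has its own side sign. Neighbouring signs agree, so the turn at one vertex
  serves as \<open>s\<close> for all edges.\<close>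

lemma convex_polygon_imp_oriented:
  assumes A: "convex_polygon n A" and n: "n \<ge> 5"
  obtains s where "oriented_polygon n s A"
proof
  define c where "c i = orient (A i) (A (i + 1)) (A (i + 2))" for i
  have per: "A (i + int n) = A i" for i
    by (rule convex_polygonD(1)[OF A])
  \<comment> \<open>The edge leaving \<open>A (i + 1)\<close> compares \<open>A i\<close>, reindexed
    as \<open>A (i + int n)\<close>, with \<open>A (i + 3)\<close>.\<close>
  have c_step: "c i * c (i + 1) > 0" for i
  proof -
    have "orient (A (i + 1)) (A (i + 1 + 1)) (A (i + int n)) * orient (A (i + 1)) (A (i + 1 + 1)) (A (i + 1 + 2)) > 0"
      by (rule convex_polygon_edge_side[OF A]) (use n in auto)
    moreover have "i + 1 + 1 = i + 2" by simp
    ultimately show ?thesis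
      by (simp only: c_def per orient_rotate[of _ _ "A i"])
  qed
  have c0: "c 0 * c i > 0" for i
  proof (induction i rule: int_induct[of _ 0])
    case base
    then show ?case using c_step[of 0] by (auto simp: zero_less_mult_iff)
  next
    case (step1 i)
    then show ?case using c_step[of i] by (auto simp: zero_less_mult_iff)
  next
    case (step2 i)
    then show ?case using c_step[of "i - 1"] by (auto simp: zero_less_mult_iff)
  qed
  show "oriented_polygon n (c 0) A"
  proof
    fix i j :: int assume "i + 1 < j" "j < i + int n"
    then have "c i * orient (A i) (A (i + 1)) (A j) > 0"
      unfolding c_def using n by (intro convex_polygon_edge_side[OF A]) auto
    then show "c 0 * orient (A i) (A (i + 1)) (A j) > 0"
      using c0[of i] by (auto simp: zero_less_mult_iff)
  qed (use n per in auto)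
qed

section \<open>Coefficients in the coordinate field\<close>

lemma affine_over_ear_sum:
  assumes S: "0 \<in> S" "\<And>x y. x \<in> S \<Longrightarrow> y \<in> S \<Longrightarrow> x + y \<in> S" "\<And>x y. x \<in> S \<Longrightarrow> y \<in> S \<Longrightarrow> x - y \<in> S"
      "\<And>x y. x \<in> S \<Longrightarrow> y \<in> S \<Longrightarrow> x * y \<in> S" "\<And>x y. x \<in> S \<Longrightarrow> y \<in> S \<Longrightarrow> x / y \<in> S"
    and A: "\<And>i. fst (A i) \<in> S" "\<And>i. snd (A i) \<in> S" and g: "\<And>i. g (A i) \<in> S"
  shows "affine_over S (ear_sum n A g)"
proof -
  have orient: "orient (A i) (A j) (A k) \<in> S" for i j k
    unfolding orient_def using A by (intro S(3,4))
  have eq: "ear_sum n A g = (\<lambda>v. \<Sum>i\<in>{0..<int n}.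
      (g (A i) / orient (A (i - 1)) (A i) (A (i + 1))) * orient (A (i - 1)) v (A (i + 1)))"
    by (simp add: ear_sum_def ear_def fun_eq_iff algebra_simps)
  show ?thesis
    unfolding eq using A g orient S by (intro affine_over_sum affine_over_scale affine_over_orient) auto
qed

lemma coordinates_in_coordinate_field:
  assumes A: "convex_polygon n A" and n: "n > 0"
  shows "complex_of_real (fst (A i)) \<in> coordinate_field n A" "complex_of_real (snd (A i)) \<in> coordinate_field n A"
proof -
  have per: "A (i + int n) = A i" for i
    by (rule convex_polygonD(1)[OF A])
  obtain j where "j \<in> {1..<1 + int n}" and Aj: "A j = A i"
    by (rule periodic_representative[of A n 1 i, OF per]) (use n in auto)
  then have "j \<in> {1..int n}" by auto
  then have "{fst (A j), snd (A j)} \<subseteq> (\<Union>i\<in>{1..int n}. {fst (A i), snd (A i)})"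
    by blast
  then show "complex_of_real (fst (A i)) \<in> coordinate_field n A" "complex_of_real (snd (A i)) \<in> coordinate_field n A"
    unfolding coordinate_field_def Aj by (auto intro!: generate_field.incl)
qed

theorem theorem1p1:
  fixes n :: nat and A :: polygon and P :: "real \<times> real"
  assumes "n \<ge> 5"
    and "convex_polygon n A"
    and "pentagram_limit A P"
  shows "\<exists>K. subfield K complex_field \<and> coordinate_field n A \<subseteq> K \<and>
           (\<exists>d\<le>3. ring.dimension complex_field d (coordinate_field n A) K) \<and>
           complex_of_real (fst P) \<in> K \<and> complex_of_real (snd P) \<in> K"
proof -
  obtain s where s: "oriented_polygon n s A"
    using convex_polygon_imp_oriented[OF assms(2,1)] .
  interpret oriented_polygon n s A by (rule s)
  define S where "S = {r. complex_of_real r \<in> coordinate_field n A}"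
  define \<mu> where "\<mu> = ear_sum n A (\<lambda>_. 1) P"
  have F: "subfield (coordinate_field n A) complex_field"
    unfolding coordinate_field_def
    by (rule field.generate_field_is_subfield[OF field_complex_field]) (simp add: complex_field_simps)
  note Fcl = subfield_complex_field_closed[OF F]
  have coord: "fst (A i) \<in> S" "snd (A i) \<in> S" for i
    using coordinates_in_coordinate_field[OF assms(2), of i] assms(1) by (simp_all add: S_def)
  have ear_S: "affine_over S (ear_sum n A g)" if "\<And>i. g (A i) \<in> S" for g
  proof (rule affine_over_ear_sum)
    show "0 \<in> S" using Fcl(1) by (simp add: S_def)
  next
    fix x y assume "x \<in> S" "y \<in> S"
    then show "x + y \<in> S" "x - y \<in> S" "x * y \<in> S" "x / y \<in> S"
      using Fcl(4-7) by (simp_all add: S_def)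
  qed (use coord that in blast)+
  obtain a1 b1 c1 where coeffs1: "a1 \<in> S" "b1 \<in> S" "c1 \<in> S"
    and M1: "\<And>v. ear_sum n A fst v = a1 + b1 * fst v + c1 * snd v"
    using ear_S[of fst] coord(1) unfolding affine_over_def by blast
  obtain a2 b2 c2 where coeffs2: "a2 \<in> S" "b2 \<in> S" "c2 \<in> S"
    and M2: "\<And>v. ear_sum n A snd v = a2 + b2 * fst v + c2 * snd v"
    using ear_S[of snd] coord(2) unfolding affine_over_def by blast
  have "1 \<in> S" using Fcl(2) by (simp add: S_def)
  then obtain a3 b3 c3 where coeffs3: "a3 \<in> S" "b3 \<in> S" "c3 \<in> S"
    and M3: "\<And>v. ear_sum n A (\<lambda>_. 1) v = a3 + b3 * fst v + c3 * snd v"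
    using ear_S[of "\<lambda>_. 1"] unfolding affine_over_def by blast
  note M = M1 M2 M3
  have eigen: "ear_sum n A g P = \<mu> * g P" if "affine_fun g" for g
    unfolding \<mu>_def by (rule pentagram_limit_eigenpoint[OF s assms(3) that])
  have "\<mu> \<le> 0"
    unfolding \<mu>_def ear_sum_def using ear_pentagram_limit_nonpos[OF s assms(3)] by (simp add: sum_nonpos)
  show ?thesis
  proof (rule eigenvector_cubic_extension[OF F])
    show "complex_of_real ` {a1, b1, c1, a2, b2, c2, a3, b3, c3} \<subseteq> coordinate_field n A"
      using coeffs1 coeffs2 coeffs3 by (simp add: S_def)
    show "a1 + b1 * fst P + c1 * snd P = \<mu> * fst P" "a2 + b2 * fst P + c2 * snd P = \<mu> * snd P"
      "a3 + b3 * fst P + c3 * snd P = \<mu>"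
      using eigen[OF affine_fun_fst] eigen[OF affine_fun_snd] eigen[OF affine_fun_const[of 1]]
      by (simp_all add: M)
  next
    fix x y
    assume xy: "a1 + b1 * x + c1 * y = \<mu> * x" "a2 + b2 * x + c2 * y = \<mu> * y" "a3 + b3 * x + c3 * y = \<mu>"
    \<comment> \<open>The functions 1, \<open>fst\<close> and \<open>snd\<close> span the affine
      functions, so the three scalar equations yield the eigenvector equation for every
      \<open>g\<close>.\<close>
    have "ear_sum n A g (x, y) = \<mu> * g (x, y)" if g_affine: "affine_fun g" for g
    proof -
      obtain a b c where g: "\<And>v. g v = a + b * fst v + c * snd v"
        using g_affine unfolding affine_over_def by blast
      have "ear_sum n A g (x, y) = a * ear_sum n A (\<lambda>_. 1) (x, y) + b * ear_sum n A fst (x, y) + c * ear_sum n A snd (x, y)"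
        by (simp add: ear_sum_def g sum_distrib_left sum.distrib algebra_simps)
      also have "\<dots> = \<mu> * g (x, y)"
        using xy by (simp add: M g algebra_simps)
      finally show ?thesis .
    qed
    then have "(x, y) = P"
      using eigen by (intro eigenpoint_unique[OF pentagram_limit_in_hull[OF s assms(3)] \<open>\<mu> \<le> 0\<close>]) blast+
    then show "x = fst P \<and> y = snd P" by auto
  qed
qed

end
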